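(* Let $I=\{1,\dots,n\}$, let $A$ be a finite set, and let $G$ be a strategic game with player set $I$, common action set $A$ and payoff functions $\pi_i:A^I\to\mathbb{R}$ ($i\in I$). Then $G$ is anonymous if and only if $i\,\mathbf{B}\,i$ holds for every player $i\in I$.
   Context: For a profile $\mathbf{a}\in A^I$ and a permutation $\sigma$ of $I$, $\mathbf{a}\sigma=(a_{\sigma(1)},\dots,a_{\sigma(n)})$. $\mathbf{a}_{-i}$ is $\mathbf{a}$ with the $i$-th coordinate deleted; for a vector $\mathbf{x}$ with entries in $A$, $\#\mathbf{x}=(\#(a,\mathbf{x}))_{a\in A}$, where $\#(a,\mathbf{x})$ is the number of coordinates of $\mathbf{x}$ equal to $a$. Anonymous: for all $i\in I$ and all $\mathbf{a},\mathbf{b}\in A^I$, if $a_i=b_i$ and $\#\mathbf{a}_{-i}=\#\mathbf{b}_{-i}$, then $\pi_i(\mathbf{a})=\pi_i(\mathbf{b})$. Blindly related players: $i\,\mathbf{B}\,j$ means that for every permutation $\sigma$ of $I$ with $\sigma(i)=j$ and $\sigma(j)=i$ and every $\mathbf{a}\in A^I$, $\pi_i(\mathbf{a})=\pi_j(\mathbf{a}\sigma)$ (with $i=j$ allowed). *)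

theory Defs
  imports Complex_Main "HOL-Library.FuncSet" "HOL-Combinatorics.Permutations"
begin

(* A game with player set I and common action set A is given by its payoff functions
   pay i, of which only the values on the profiles, the extensional functions in
   PiE I A, matter. More generally, a vector with entries in A and index set J is an
   element of PiE J A. *)

type_synonym ('i, 'a) payoffs = "'i \<Rightarrow> ('i \<Rightarrow> 'a) \<Rightarrow> real"

definition profiles :: "'i set \<Rightarrow> 'a set \<Rightarrow> ('i \<Rightarrow> 'a) set" where
  "profiles I A = (I \<rightarrow>\<^sub>E A)"

definition permute_profile :: "'i set \<Rightarrow> ('i \<Rightarrow> 'a) \<Rightarrow> ('i \<Rightarrow> 'i) \<Rightarrow> ('i \<Rightarrow> 'a)" where
  "permute_profile I a \<sigma> = (\<lambda>k\<in>I. a (\<sigma> k))"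

(* The remaining coordinates keep their labels: the result is a vector over I - {i}. *)
definition delete_coord :: "'i set \<Rightarrow> ('i \<Rightarrow> 'a) \<Rightarrow> 'i \<Rightarrow> ('i \<Rightarrow> 'a)" where
  "delete_coord I a i = (\<lambda>k\<in>I - {i}. a k)"

definition action_counts :: "'i set \<Rightarrow> 'a set \<Rightarrow> ('i \<Rightarrow> 'a) \<Rightarrow> ('a \<Rightarrow> nat)" where
  "action_counts J A x = (\<lambda>c\<in>A. card {k \<in> J. x k = c})"

definition anonymous :: "'i set \<Rightarrow> 'a set \<Rightarrow> ('i, 'a) payoffs \<Rightarrow> bool" where
  "anonymous I A pay \<longleftrightarrow>
     (\<forall>i\<in>I. \<forall>a\<in>profiles I A. \<forall>b\<in>profiles I A.
        a i = b i \<and>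
        action_counts (I - {i}) A (delete_coord I a i) =
          action_counts (I - {i}) A (delete_coord I b i) \<longrightarrow>
        pay i a = pay i b)"

definition blindly_related ::
  "'i set \<Rightarrow> 'a set \<Rightarrow> ('i, 'a) payoffs \<Rightarrow> 'i \<Rightarrow> 'i \<Rightarrow> bool" where
  "blindly_related I A pay i j \<longleftrightarrow>
     (\<forall>\<sigma>. \<sigma> permutes I \<and> \<sigma> i = j \<and> \<sigma> j = i \<longrightarrow>
        (\<forall>a\<in>profiles I A. pay i a = pay j (permute_profile I a \<sigma>)))"

end

theory Submission
  imports Defs
begin

text \<open>
  Both notions forbid the payoff of \<open>i\<close> to depend on which of the other players takes which
  action. Anonymity says this by invariants: two profiles are indistinguishable for \<open>i\<close> if \<open>i\<close>
  plays the same action in both and the actions of the others are equally distributed. The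
  relation of \<open>i\<close> to itself says it by a group action: the payoff is constant on the orbits of the
  permutations that fix \<open>i\<close>. Such permutations are exactly the permutations of \<open>I - {i}\<close>,
  and the orbits of the permutations of a finite index set on vectors are
  classified by the action counts (lemma \<open>action_counts_eq_iff_permutation\<close>). The two invariance
  conditions therefore range over the same pairs of profiles.
\<close>

text \<open>
  If the counts agree, then the multisets of entries agree: an action outside \<open>A\<close> occurs in
  neither vector. Equal multisets yield a permutation that matches the entries. Conversely, a
  permutation maps the positions of an action in one vector bijectively to those in the other.
\<close>
lemma action_counts_eq_iff_permutation:
  assumes "finite J" and "x ` J \<subseteq> A" and "y ` J \<subseteq> A"
  shows "action_counts J A x = action_counts J A y \<longleftrightarrow>
         (\<exists>\<tau>. \<tau> permutes J \<and> (\<forall>k\<in>J. x k = y (\<tau> k)))"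
proof
  assume counts: "action_counts J A x = action_counts J A y"
  have "card {k \<in> J. x k = c} = card {k \<in> J. y k = c}" for c
  proof (cases "c \<in> A")
    case True
    then show ?thesis using fun_cong[OF counts, of c] by (simp add: action_counts_def)
  next
    case False
    then have "{k \<in> J. x k = c} = {}" "{k \<in> J. y k = c} = {}"
      using assms by auto
    then show ?thesis by (simp only:)
  qed
  then have "image_mset x (mset_set J) = image_mset y (mset_set J)"
    using \<open>finite J\<close> by (intro multiset_eqI) (simp add: count_image_mset_eq_card_vimage)
  then show "\<exists>\<tau>. \<tau> permutes J \<and> (\<forall>k\<in>J. x k = y (\<tau> k))"
    using image_mset_eq_implies_permutes[OF \<open>finite J\<close>] by metis
next
  assume "\<exists>\<tau>. \<tau> permutes J \<and> (\<forall>k\<in>J. x k = y (\<tau> k))"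
  then obtain \<tau> where \<tau>: "\<tau> permutes J" and xy: "\<forall>k\<in>J. x k = y (\<tau> k)" by blast
  have "card {k \<in> J. x k = c} = card {k \<in> J. y k = c}" for c
  proof -
    have "\<tau> ` {k \<in> J. x k = c} = {k \<in> J. y k = c}"
    proof
      show "\<tau> ` {k \<in> J. x k = c} \<subseteq> {k \<in> J. y k = c}"
        using xy permutes_in_image[OF \<tau>] by auto
      show "{k \<in> J. y k = c} \<subseteq> \<tau> ` {k \<in> J. x k = c}"
        using xy permutes_image[OF \<tau>] by fastforce
    qed
    then show ?thesis
      using card_image[OF inj_on_subset[OF permutes_inj[OF \<tau>] subset_UNIV]] by metis
  qed
  then show "action_counts J A x = action_counts J A y"
    by (simp add: action_counts_def)
qed

lemma permutes_Diff_singleton_iff: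
  assumes "i \<in> I"
  shows "\<sigma> permutes I - {i} \<longleftrightarrow> \<sigma> permutes I \<and> \<sigma> i = i"
  using permutes_subset[of \<sigma> "I - {i}" I] permutes_not_in[of \<sigma> "I - {i}" i]
    permutes_superset[of \<sigma> I "I - {i}"] by auto

lemma permute_profile_in_profiles:
  assumes "\<sigma> permutes I" and "a \<in> profiles I A"
  shows "permute_profile I a \<sigma> \<in> profiles I A"
  using assms permutes_in_image[OF assms(1)]
  by (auto simp: profiles_def permute_profile_def PiE_iff)

text \<open>
  A permutation of the others' coordinates, obtained from their equal counts, extends to \<open>I\<close> by
  the fixed point \<open>i\<close>, because the profiles agree there.
\<close>
lemma same_action_and_counts_iff_permuted:
  assumes "finite I" and "i \<in> I" and a: "a \<in> profiles I A" and b: "b \<in> profiles I A"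
  shows "a i = b i \<and>
         action_counts (I - {i}) A (delete_coord I a i) =
           action_counts (I - {i}) A (delete_coord I b i) \<longleftrightarrow>
         (\<exists>\<sigma>. \<sigma> permutes I \<and> \<sigma> i = i \<and> a = permute_profile I b \<sigma>)"
    (is "?same \<longleftrightarrow> ?permuted")
proof -
  have range: "delete_coord I a i ` (I - {i}) \<subseteq> A" "delete_coord I b i ` (I - {i}) \<subseteq> A"
    using a b by (auto simp: delete_coord_def profiles_def)
  have "?same \<longleftrightarrow> a i = b i \<and> (\<exists>\<sigma>. \<sigma> permutes I - {i} \<and>
           (\<forall>k\<in>I - {i}. delete_coord I a i k = delete_coord I b i (\<sigma> k)))"
    using action_counts_eq_iff_permutation[OF _ range] \<open>finite I\<close> by simp
  also have "\<dots> \<longleftrightarrow> (\<exists>\<sigma>. \<sigma> permutes I - {i} \<and> a i = b i \<and> (\<forall>k\<in>I - {i}. a k = b (\<sigma> k)))"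
    using permutes_in_image[of _ "I - {i}"] by (fastforce simp: delete_coord_def)
  also have "\<dots> \<longleftrightarrow> (\<exists>\<sigma>. \<sigma> permutes I \<and> \<sigma> i = i \<and> (\<forall>k\<in>I. a k = b (\<sigma> k)))"
  proof -
    have "(\<forall>k\<in>I. a k = b (\<sigma> k)) \<longleftrightarrow> a i = b (\<sigma> i) \<and> (\<forall>k\<in>I - {i}. a k = b (\<sigma> k))" for \<sigma>
      using \<open>i \<in> I\<close> by blast
    then show ?thesis
      unfolding permutes_Diff_singleton_iff[OF \<open>i \<in> I\<close>] by metis
  qed
  also have "\<dots> \<longleftrightarrow> ?permuted"
  proof -
    have "(\<forall>k\<in>I. a k = b (\<sigma> k)) \<longleftrightarrow> a = permute_profile I b \<sigma>" for \<sigma>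
      using a by (auto simp: permute_profile_def profiles_def PiE_iff fun_eq_iff extensional_def)
    then show ?thesis by simp
  qed
  finally show ?thesis .
qed

theorem anonymous_iff_blindly_related_refl:
  assumes "finite I"
  shows "anonymous I A pay \<longleftrightarrow> (\<forall>i\<in>I. blindly_related I A pay i i)"
proof -
  have "anonymous I A pay \<longleftrightarrow>
          (\<forall>i\<in>I. \<forall>a\<in>profiles I A. \<forall>b\<in>profiles I A.
             (\<exists>\<sigma>. \<sigma> permutes I \<and> \<sigma> i = i \<and> a = permute_profile I b \<sigma>) \<longrightarrow> pay i a = pay i b)"
    unfolding anonymous_def
    by (simp add: same_action_and_counts_iff_permuted[OF assms] cong: ball_cong)
  also have "\<dots> \<longleftrightarrow> (\<forall>i\<in>I. blindly_related I A pay i i)"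
    unfolding blindly_related_def using permute_profile_in_profiles by metis
  finally show ?thesis .
qed

theorem lemma5p4:
  fixes n :: nat
    and A :: "'a set"
    and \<pi> :: "nat \<Rightarrow> (nat \<Rightarrow> 'a) \<Rightarrow> real"
  assumes "finite A"
  shows "anonymous {1..n} A \<pi> \<longleftrightarrow> (\<forall>i\<in>{1..n}. blindly_related {1..n} A \<pi> i i)"
  by (rule anonymous_iff_blindly_related_refl) simp

end
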